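(* Let $X$ be a set. (1) Giving a solution $R$ on $X$ is equivalent to specifying: an idempotent function $h:X\to X$; two sets $A$, $B$ and maps (projections) $\pi_1:\mathrm{Im}\,h\to A$ and $\pi_2:\mathrm{Im}\,h\to B$ such that $(\pi_1,\pi_2):\mathrm{Im}\,h\to A\times B$ is a bijection, by which $\mathrm{Im}\,h$ is identified with $A\times B$; and a function $\vartheta':B\to B$. That is, for any such data the map $R:X\times X\to X\times X$ given for $x,y\in X$ by $$R(x,y)=\bigl((\pi_1hx,\ \pi_2hy),\ (\pi_1hy,\ \vartheta'\pi_2hx)\bigr)$$ (where $A\times B\cong\mathrm{Im}\,h\subseteq X$) is a solution on $X$, and every solution on $X$ arises in this way from such data, which are unique up to relabelling $A$ and $B$ by bijections. (2) The automorphisms of a solution $R$ given by data as in (1) are precisely the permutations $\sigma\in\Sigma_X$ such that: $\sigma\circ h=h\circ\sigma$; $\sigma$ induces permutations $\sigma_A$ of $A$ and $\sigma_B$ of $B$ via $\pi_1$ and $\pi_2$ respectively (i.e. $\pi_1\circ\sigma|_{\mathrm{Im}\,h}=\sigma_A\circ\pi_1$ and $\pi_2\circ\sigma|_{\mathrm{Im}\,h}=\sigma_B\circ\pi_2$); and $\sigma_B\circ\vartheta'=\vartheta'\circ\sigma_B$.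
   Context: All sets are non-empty. $\Sigma_X$ is the group of all permutations of $X$. For a set $X$ let $\tau_X(x,y)=(y,x)$ be the flip map on $X\times X$. For a map $R:X\times X\to X\times X$ put, as maps $X^3\to X^3$, $R^{12}=R\times \mathrm{Id}_X$, $R^{23}=\mathrm{Id}_X\times R$, $R^{13}=(\mathrm{Id}_X\times\tau_X)\circ R^{12}\circ(\mathrm{Id}_X\times\tau_X)$. $R$ is called a solution on $X$ (of the set-theoretic Frobenius-Separability equation) if $R^{12}R^{23}=R^{23}R^{13}=R^{13}R^{12}$. An automorphism of a solution $R$ on $X$ is a permutation $\sigma\in\Sigma_X$ with $(\sigma\times\sigma)\circ R=R\circ(\sigma\times\sigma)$. *)

theory Defs
  imports Main "HOL-Library.FuncSet"
begin

text \<open>The set \<open>X\<close> is the type \<open>'x\<close> (types are non-empty), so permutations of \<open>X\<close> are the bijections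
  of \<open>'x\<close>. Elements of \<open>X\<^sup>3\<close> are right-nested triples.\<close>

definition flip :: "'x \<times> 'x \<Rightarrow> 'x \<times> 'x" where
  "flip = (\<lambda>(x, y). (y, x))"

definition R12 :: "('x \<times> 'x \<Rightarrow> 'x \<times> 'x) \<Rightarrow> 'x \<times> 'x \<times> 'x \<Rightarrow> 'x \<times> 'x \<times> 'x" where
  "R12 R = (\<lambda>(x, y, z). (fst (R (x, y)), snd (R (x, y)), z))"

definition R23 :: "('x \<times> 'x \<Rightarrow> 'x \<times> 'x) \<Rightarrow> 'x \<times> 'x \<times> 'x \<Rightarrow> 'x \<times> 'x \<times> 'x" where
  "R23 R = map_prod id R"

definition R13 :: "('x \<times> 'x \<Rightarrow> 'x \<times> 'x) \<Rightarrow> 'x \<times> 'x \<times> 'x \<Rightarrow> 'x \<times> 'x \<times> 'x" where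
  "R13 R = map_prod id flip \<circ> R12 R \<circ> map_prod id flip"

definition fs_solution :: "('x \<times> 'x \<Rightarrow> 'x \<times> 'x) \<Rightarrow> bool" where
  "fs_solution R \<longleftrightarrow>
     R12 R \<circ> R23 R = R23 R \<circ> R13 R \<and> R23 R \<circ> R13 R = R13 R \<circ> R12 R"

definition fs_automorphism :: "('x \<times> 'x \<Rightarrow> 'x \<times> 'x) \<Rightarrow> ('x \<Rightarrow> 'x) \<Rightarrow> bool" where
  "fs_automorphism R \<sigma> \<longleftrightarrow> bij \<sigma> \<and> map_prod \<sigma> \<sigma> \<circ> R = R \<circ> map_prod \<sigma> \<sigma>"

text \<open>Maps out of \<open>Im h\<close> and out of \<open>B\<close> are represented by total functions of which only the
  values on \<open>range h\<close>, respectively \<open>B\<close>, are relevant.\<close>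

definition fs_data ::
  "('x \<Rightarrow> 'x) \<Rightarrow> 'a set \<Rightarrow> 'b set \<Rightarrow> ('x \<Rightarrow> 'a) \<Rightarrow> ('x \<Rightarrow> 'b) \<Rightarrow> ('b \<Rightarrow> 'b) \<Rightarrow> bool" where
  "fs_data h A B \<pi>1 \<pi>2 \<theta> \<longleftrightarrow>
     h \<circ> h = h \<and> A \<noteq> {} \<and> B \<noteq> {} \<and>
     \<pi>1 \<in> range h \<rightarrow> A \<and> \<pi>2 \<in> range h \<rightarrow> B \<and>
     bij_betw (\<lambda>p. (\<pi>1 p, \<pi>2 p)) (range h) (A \<times> B) \<and>
     \<theta> \<in> B \<rightarrow> B"

text \<open>The identification of \<open>A \<times> B\<close> with \<open>Im h\<close>, i.e. the inverse of \<open>(\<pi>1, \<pi>2)\<close>; it is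
  meaningful on \<open>A \<times> B\<close> only.\<close>

definition fs_pair :: "('x \<Rightarrow> 'x) \<Rightarrow> ('x \<Rightarrow> 'a) \<Rightarrow> ('x \<Rightarrow> 'b) \<Rightarrow> 'a \<times> 'b \<Rightarrow> 'x" where
  "fs_pair h \<pi>1 \<pi>2 = the_inv_into (range h) (\<lambda>p. (\<pi>1 p, \<pi>2 p))"

definition fs_map ::
  "('x \<Rightarrow> 'x) \<Rightarrow> ('x \<Rightarrow> 'a) \<Rightarrow> ('x \<Rightarrow> 'b) \<Rightarrow> ('b \<Rightarrow> 'b) \<Rightarrow> 'x \<times> 'x \<Rightarrow> 'x \<times> 'x" where
  "fs_map h \<pi>1 \<pi>2 \<theta> = (\<lambda>(x, y).
     (fs_pair h \<pi>1 \<pi>2 (\<pi>1 (h x), \<pi>2 (h y)),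
      fs_pair h \<pi>1 \<pi>2 (\<pi>1 (h y), \<theta> (\<pi>2 (h x)))))"

end

theory Submission imports Defs
begin

text \<open>
  Write \<open>R (x, y) = (x \<cdot> y, x * y)\<close>. Comparing components, the equation says that
  \<open>x \<cdot> (y \<cdot> z) = x \<cdot> z = (x \<cdot> y) \<cdot> z\<close>,
  \<open>x * (y \<cdot> z) = y \<cdot> (x * z) = x * y\<close> and \<open>y * z = y * (x * z) = (x \<cdot> y) * z\<close>.
  So \<open>\<cdot>\<close> is an associative operation in which inner factors can be dropped. Squaring,
  \<open>h x = x \<cdot> x\<close>, is then an idempotent map onto the set of all products, where \<open>\<cdot>\<close> is a rectangular
  band. Rectangular bands are products \<open>A \<times> B\<close> with \<open>(a, b) \<cdot> (a', b') = (a, b')\<close>: after a base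
  point \<open>e\<close> has been chosen, the coordinates of \<open>p\<close> are \<open>p \<cdot> e\<close> and \<open>e \<cdot> p\<close>. The identities for
  \<open>*\<close> say that \<open>x * y\<close> is a product whose first coordinate is that of \<open>y\<close> and whose second
  coordinate depends only on the second coordinate of \<open>x\<close>; this dependence is \<open>\<theta>\<close>
  (lemma \<open>fs_solution_has_data\<close>). That the data always give a solution is a computation in coordinates.

  The data can be read off from the map: \<open>h x\<close> is the first component of \<open>R (x, x)\<close>, and for \<open>p\<close>,
  \<open>q\<close> in the image of \<open>h\<close> that component of \<open>R (p, q)\<close> is \<open>q\<close> precisely when \<open>p\<close> and \<open>q\<close> have the same
  first coordinate, and \<open>p\<close> precisely when they have the same second coordinate. Thus the two coordinate
  partitions are intrinsic, and only the names of their blocks, the elements of \<open>A\<close> and \<open>B\<close>,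
  are free (lemma \<open>fs_map_eq_iff_relabelling\<close>).

  Automorphisms reduce to this uniqueness: conjugating \<open>R\<close> by a permutation \<open>\<sigma>\<close> yields the map of
  the data pulled back along \<open>\<sigma>\<close> (lemma \<open>fs_map_pullback\<close>), so \<open>\<sigma>\<close> is an automorphism iff the
  original and the pulled-back data agree up to relabelling, and the relabellings are \<open>\<sigma>\<^sub>A\<close> and
  \<open>\<sigma>\<^sub>B\<close>.
\<close>

section \<open>Coordinates on the image of the idempotent\<close>

context
  fixes h :: "'x \<Rightarrow> 'x" and A :: "'a set" and B :: "'b set"
    and \<pi>1 :: "'x \<Rightarrow> 'a" and \<pi>2 :: "'x \<Rightarrow> 'b" and \<theta> :: "'b \<Rightarrow> 'b"
  assumes data: "fs_data h A B \<pi>1 \<pi>2 \<theta>"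
begin

lemma fs_data_idem: "h (h x) = h x"
  using data by (metis comp_apply fs_data_def)

lemma fs_data_fixed: "p \<in> range h \<Longrightarrow> h p = p"
  using fs_data_idem by blast

lemma fs_data_pi1_mem: "p \<in> range h \<Longrightarrow> \<pi>1 p \<in> A"
  and fs_data_pi2_mem: "p \<in> range h \<Longrightarrow> \<pi>2 p \<in> B"
  and fs_data_theta_mem: "b \<in> B \<Longrightarrow> \<theta> b \<in> B"
  using data unfolding fs_data_def by blast+

lemma fs_data_coords_eqI:
  "p \<in> range h \<Longrightarrow> q \<in> range h \<Longrightarrow> \<pi>1 p = \<pi>1 q \<Longrightarrow> \<pi>2 p = \<pi>2 q \<Longrightarrow> p = q"
  using data unfolding fs_data_def bij_betw_def inj_on_def by blast

lemma fs_pair_mem_coords: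
  assumes "a \<in> A" "b \<in> B"
  shows "fs_pair h \<pi>1 \<pi>2 (a, b) \<in> range h \<and> \<pi>1 (fs_pair h \<pi>1 \<pi>2 (a, b)) = a
    \<and> \<pi>2 (fs_pair h \<pi>1 \<pi>2 (a, b)) = b"
proof -
  have inj: "inj_on (\<lambda>p. (\<pi>1 p, \<pi>2 p)) (range h)"
    and img: "(a, b) \<in> (\<lambda>p. (\<pi>1 p, \<pi>2 p)) ` range h"
    using data assms unfolding fs_data_def bij_betw_def by auto
  show ?thesis
    using f_the_inv_into_f[OF inj img] the_inv_into_into[OF inj img order_refl]
    unfolding fs_pair_def by simp
qed

text \<open>Each projection of \<open>A \<times> B\<close> is onto because the other factor is non-empty.\<close>

lemma fs_data_pi1_image: "\<pi>1 ` range h = A"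
  and fs_data_pi2_image: "\<pi>2 ` range h = B"
proof -
  obtain a b where "a \<in> A" "b \<in> B" using data unfolding fs_data_def by blast
  then have "A \<subseteq> \<pi>1 ` range h" "B \<subseteq> \<pi>2 ` range h"
    using fs_pair_mem_coords by (metis image_eqI subsetI)+
  then show "\<pi>1 ` range h = A" "\<pi>2 ` range h = B"
    using fs_data_pi1_mem fs_data_pi2_mem by blast+
qed

text \<open>Since points of the image of \<open>h\<close> are determined by their coordinates, the map is described
  by coordinate equations. In this form two maps can be compared without knowing the partial
  inverses \<open>fs_pair\<close> from which they are built.\<close>

lemma fs_map_eq_iff_coords:
  "fs_map h \<pi>1 \<pi>2 \<theta> (x, y) = (p, q) \<longleftrightarrow>
    p \<in> range h \<and> q \<in> range h \<and> \<pi>1 p = \<pi>1 (h x) \<and> \<pi>2 p = \<pi>2 (h y) \<and>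
    \<pi>1 q = \<pi>1 (h y) \<and> \<pi>2 q = \<theta> (\<pi>2 (h x))"
  (is "?l \<longleftrightarrow> ?r")
proof -
  have mem: "\<pi>1 (h x) \<in> A" "\<pi>1 (h y) \<in> A" "\<pi>2 (h y) \<in> B" "\<theta> (\<pi>2 (h x)) \<in> B"
    by (simp_all add: fs_data_pi1_mem fs_data_pi2_mem fs_data_theta_mem)
  note first = fs_pair_mem_coords[OF mem(1,3)] and second = fs_pair_mem_coords[OF mem(2,4)]
  show ?thesis
  proof
    assume ?l
    then show ?r using first second by (auto simp: fs_map_def)
  next
    assume ?r
    then show ?l
      using first second by (auto simp: fs_map_def intro: fs_data_coords_eqI)
  qed
qed

lemma fs_map_value_coords:
  fixes x y :: 'x
  defines "p \<equiv> fst (fs_map h \<pi>1 \<pi>2 \<theta> (x, y))" and "q \<equiv> snd (fs_map h \<pi>1 \<pi>2 \<theta> (x, y))"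
  shows "p \<in> range h" "q \<in> range h" "\<pi>1 p = \<pi>1 (h x)" "\<pi>2 p = \<pi>2 (h y)"
    "\<pi>1 q = \<pi>1 (h y)" "\<pi>2 q = \<theta> (\<pi>2 (h x))"
  using fs_map_eq_iff_coords[of x y p q] unfolding p_def q_def by simp_all

text \<open>With \<open>(a\<^sub>i, b\<^sub>i)\<close> the coordinates of the image under \<open>h\<close> of the \<open>i\<close>-th entry, all three
  composites send the triple to \<open>((a\<^sub>1, b\<^sub>3), (a\<^sub>2, \<theta> b\<^sub>1), (a\<^sub>3, \<theta> b\<^sub>2))\<close>.\<close>

lemma fs_map_solution: "fs_solution (fs_map h \<pi>1 \<pi>2 \<theta>)"
proof -
  let ?c = "fs_pair h \<pi>1 \<pi>2"
  have mem: "\<pi>1 (h x) \<in> A" "\<pi>2 (h x) \<in> B" "\<theta> (\<pi>2 (h x)) \<in> B" for x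
    by (simp_all add: fs_data_pi1_mem fs_data_pi2_mem fs_data_theta_mem)
  have pair: "h (?c (a, b)) = ?c (a, b)" "\<pi>1 (?c (a, b)) = a" "\<pi>2 (?c (a, b)) = b"
    if "a \<in> A" "b \<in> B" for a b
    using fs_pair_mem_coords[OF that] fs_data_fixed by blast+
  show ?thesis
    unfolding fs_solution_def
    by (simp add: fun_eq_iff R12_def R23_def R13_def flip_def fs_map_def mem pair)
qed

lemma fs_map_diagonal: "fst (fs_map h \<pi>1 \<pi>2 \<theta> (x, x)) = h x"
  using fs_map_value_coords[of x x] by (auto intro: fs_data_coords_eqI)

text \<open>The next two facts recover the partitions of the image of \<open>h\<close> into blocks of equal first,
  respectively second, coordinate from the map alone: its first component has the first coordinate
  of \<open>p\<close> and the second coordinate of \<open>q\<close>.\<close>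

lemma fs_map_fst_eq_right_iff:
  assumes "p \<in> range h" "q \<in> range h"
  shows "fst (fs_map h \<pi>1 \<pi>2 \<theta> (p, q)) = q \<longleftrightarrow> \<pi>1 p = \<pi>1 q"
  using fs_map_value_coords[of p q] assms fs_data_fixed fs_data_coords_eqI by metis

lemma fs_map_fst_eq_left_iff:
  assumes "p \<in> range h" "q \<in> range h"
  shows "fst (fs_map h \<pi>1 \<pi>2 \<theta> (p, q)) = p \<longleftrightarrow> \<pi>2 p = \<pi>2 q"
  using fs_map_value_coords[of p q] assms fs_data_fixed fs_data_coords_eqI by metis

end

section \<open>Every solution comes from data\<close>

text \<open>With \<open>m x y = x \<cdot> y\<close>, \<open>s x y = x * y\<close> and an arbitrary base point \<open>e\<close>, the inverse of the
  coordinate map \<open>p \<mapsto> (p \<cdot> e, e \<cdot> p)\<close> is \<open>(a, b) \<mapsto> a \<cdot> b\<close>.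
  Since \<open>x * y = y \<cdot> (x * e)\<close>, the second coordinate of \<open>x * y\<close> is \<open>e \<cdot> (x * e)\<close>.
  This suggests \<open>\<theta> b = e \<cdot> (b * e)\<close>, as \<open>(e \<cdot> x) * e = x * e\<close>.\<close>

lemma fs_solution_has_data:
  fixes R :: "'x \<times> 'x \<Rightarrow> 'x \<times> 'x"
  assumes "fs_solution R"
  shows "\<exists>h (A :: 'x set) (B :: 'x set) \<pi>1 \<pi>2 \<theta>. fs_data h A B \<pi>1 \<pi>2 \<theta> \<and> R = fs_map h \<pi>1 \<pi>2 \<theta>"
proof -
  define m where "m x y = fst (R (x, y))" for x y
  define s where "s x y = snd (R (x, y))" for x y
  have R: "R (x, y) = (m x y, s x y)" for x y
    by (simp add: m_def s_def)
  have m_assoc: "m x (m y z) = m x z" "m (m x y) z = m x z"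
    and s_m: "s x (m y z) = s x y" "m y (s x z) = s x y" "s (m x y) z = s y z" for x y z
    using assms unfolding fs_solution_def
    by (simp_all add: fun_eq_iff R12_def R23_def R13_def flip_def R) metis
  define h where "h x = m x x" for x
  fix e :: 'x
  define \<pi>1 where "\<pi>1 p = m p e" for p
  define \<pi>2 where "\<pi>2 p = m e p" for p
  define \<theta> where "\<theta> b = m e (s b e)" for b
  define A where "A = range \<pi>1"
  define B where "B = range \<pi>2"
  have m_range: "m x y \<in> range h" for x y
    by (rule image_eqI[of _ _ "m x y"]) (simp_all add: h_def m_assoc)
  have on_range: "m p p = p" if "p \<in> range h" for p
    using that by (auto simp: h_def m_assoc)
  have coords_mult: "m (\<pi>1 p) (\<pi>2 q) = m p q" for p q
    by (simp add: \<pi>1_def \<pi>2_def m_assoc)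
  have mult_coords: "\<pi>1 (m p q) = \<pi>1 p" "\<pi>2 (m p q) = \<pi>2 q" for p q
    by (simp_all add: \<pi>1_def \<pi>2_def m_assoc)
  have bij: "bij_betw (\<lambda>p. (\<pi>1 p, \<pi>2 p)) (range h) (A \<times> B)"
  proof (rule bij_betw_byWitness[where f' = "\<lambda>(a, b). m a b"])
    show "\<forall>p\<in>range h. (case (\<pi>1 p, \<pi>2 p) of (a, b) \<Rightarrow> m a b) = p"
      by (simp add: coords_mult on_range del: image_iff)
    show "\<forall>c\<in>A \<times> B. (\<pi>1 (case c of (a, b) \<Rightarrow> m a b), \<pi>2 (case c of (a, b) \<Rightarrow> m a b)) = c"
      by (auto simp: A_def B_def \<pi>1_def \<pi>2_def m_assoc)
    show "(\<lambda>p. (\<pi>1 p, \<pi>2 p)) ` range h \<subseteq> A \<times> B"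
      by (auto simp: A_def B_def)
    show "(\<lambda>(a, b). m a b) ` (A \<times> B) \<subseteq> range h"
      using m_range by auto
  qed
  have data: "fs_data h A B \<pi>1 \<pi>2 \<theta>"
    unfolding fs_data_def
    using bij by (auto simp: fun_eq_iff h_def m_assoc A_def B_def \<theta>_def \<pi>2_def)
  have "fs_map h \<pi>1 \<pi>2 \<theta> (x, y) = (m x y, s x y)" for x y
    unfolding fs_map_eq_iff_coords[OF data]
  proof (intro conjI)
    have s_eq: "s x y = m y (s x e)"
      by (simp add: s_m)
    show "s x y \<in> range h"
      unfolding s_eq by (rule m_range)
    show "\<pi>1 (s x y) = \<pi>1 (h y)"
      unfolding s_eq by (simp add: mult_coords h_def)
    show "\<pi>2 (s x y) = \<theta> (\<pi>2 (h x))"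
      unfolding s_eq \<theta>_def \<pi>2_def by (simp add: h_def m_assoc s_m(3))
    show "m x y \<in> range h"
      by (rule m_range)
  qed (simp_all add: mult_coords h_def)
  then have "R = fs_map h \<pi>1 \<pi>2 \<theta>"
    by (auto simp: fun_eq_iff R)
  with data show ?thesis by blast
qed

section \<open>Uniqueness of the data\<close>

lemma same_kernel_bij_betw:
  assumes "f ` S = A" "g ` S = B" "\<And>p q. p \<in> S \<Longrightarrow> q \<in> S \<Longrightarrow> f p = f q \<longleftrightarrow> g p = g q"
  obtains \<alpha> where "bij_betw \<alpha> A B" "\<And>p. p \<in> S \<Longrightarrow> g p = \<alpha> (f p)"
proof -
  define \<alpha> where "\<alpha> a = g (inv_into S f a)" for a
  have eq: "g p = \<alpha> (f p)" if "p \<in> S" for p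
    using assms(3)[OF that inv_into_into[of "f p" f S]] that
    by (simp add: \<alpha>_def f_inv_into_f)
  have "\<alpha> ` A = B"
    unfolding assms(1,2)[symmetric] image_image using eq by simp
  moreover have "inj_on \<alpha> A"
    unfolding assms(1)[symmetric] by (rule inj_onI) (use eq assms(3) in fastforce)
  ultimately show ?thesis
    using that eq unfolding bij_betw_def by blast
qed

lemma fs_map_eq_iff_relabelling:
  assumes data: "fs_data h A B \<pi>1 \<pi>2 \<theta>" and data': "fs_data h' A' B' \<pi>1' \<pi>2' \<theta>'"
  shows "fs_map h \<pi>1 \<pi>2 \<theta> = fs_map h' \<pi>1' \<pi>2' \<theta>' \<longleftrightarrow>
    h = h' \<and>
    (\<exists>\<alpha> \<beta>. bij_betw \<alpha> A A' \<and> bij_betw \<beta> B B' \<and>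
       (\<forall>p \<in> range h. \<pi>1' p = \<alpha> (\<pi>1 p)) \<and>
       (\<forall>p \<in> range h. \<pi>2' p = \<beta> (\<pi>2 p)) \<and>
       (\<forall>b \<in> B. \<theta>' (\<beta> b) = \<beta> (\<theta> b)))"
    (is "?R = ?R' \<longleftrightarrow> h = h' \<and> ?relabel")
proof
  assume eq: "?R = ?R'"
  have h: "h = h'"
    using fs_map_diagonal[OF data] fs_map_diagonal[OF data'] eq by (metis ext)
  have ker1: "\<pi>1 p = \<pi>1 q \<longleftrightarrow> \<pi>1' p = \<pi>1' q"
    and ker2: "\<pi>2 p = \<pi>2 q \<longleftrightarrow> \<pi>2' p = \<pi>2' q" if "p \<in> range h" "q \<in> range h" for p q
    using fs_map_fst_eq_right_iff[OF data that] fs_map_fst_eq_left_iff[OF data that]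
      fs_map_fst_eq_right_iff[OF data' that[unfolded h]]
      fs_map_fst_eq_left_iff[OF data' that[unfolded h]] eq by simp_all
  obtain \<alpha> where \<alpha>: "bij_betw \<alpha> A A'" "\<And>p. p \<in> range h \<Longrightarrow> \<pi>1' p = \<alpha> (\<pi>1 p)"
    using same_kernel_bij_betw[OF fs_data_pi1_image[OF data]
        fs_data_pi1_image[OF data', folded h] ker1] by blast
  obtain \<beta> where \<beta>: "bij_betw \<beta> B B'" "\<And>p. p \<in> range h \<Longrightarrow> \<pi>2' p = \<beta> (\<pi>2 p)"
    using same_kernel_bij_betw[OF fs_data_pi2_image[OF data]
        fs_data_pi2_image[OF data', folded h] ker2] by blast
  have "\<theta>' (\<beta> b) = \<beta> (\<theta> b)" if "b \<in> B" for b
  proof -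
    obtain p where p: "p \<in> range h" "b = \<pi>2 p"
      using \<open>b \<in> B\<close> fs_data_pi2_image[OF data] by blast
    have fixed: "h p = p" "h' p = p"
      using fs_data_fixed[OF data p(1)] h by simp_all
    \<comment> \<open>The second coordinate of \<open>snd (R (p, p))\<close> is \<open>\<theta> b\<close> in one system and \<open>\<theta>' (\<beta> b)\<close> in the other.\<close>
    have "\<theta>' (\<beta> b) = \<pi>2' (snd (?R (p, p)))"
      using fs_map_value_coords(6)[OF data', of p p] eq p \<beta>(2) fixed by simp
    also have "\<dots> = \<beta> (\<theta> b)"
      using \<beta>(2) fs_map_value_coords(2,6)[OF data, of p p] p(2) fixed by simp
    finally show ?thesis .
  qed
  with h \<alpha> \<beta> show "h = h' \<and> ?relabel" by blast
next
  assume "h = h' \<and> ?relabel"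
  then obtain \<alpha> \<beta> where h: "h = h'"
    and \<alpha>: "\<And>p. p \<in> range h \<Longrightarrow> \<pi>1' p = \<alpha> (\<pi>1 p)"
    and \<beta>: "\<And>p. p \<in> range h \<Longrightarrow> \<pi>2' p = \<beta> (\<pi>2 p)"
    and \<theta>: "\<And>b. b \<in> B \<Longrightarrow> \<theta>' (\<beta> b) = \<beta> (\<theta> b)" by blast
  have "?R' (x, y) = (fst (?R (x, y)), snd (?R (x, y)))" for x y
    unfolding fs_map_eq_iff_coords[OF data']
    using fs_map_value_coords[OF data, of x y]
    by (simp add: h[symmetric] \<alpha> \<beta> \<theta> fs_data_pi2_mem[OF data])
  then show "?R = ?R'" by (auto simp: fun_eq_iff)
qed

section \<open>Automorphisms\<close>

text \<open>Pulling the data back along \<open>\<sigma>\<close> replaces \<open>h\<close> by \<open>\<sigma>\<^sup>-\<^sup>1 \<circ> h \<circ> \<sigma>\<close>, whose image is mapped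
  bijectively onto that of \<open>h\<close> by \<open>\<sigma>\<close>.\<close>

lemma fs_data_pullback:
  assumes data: "fs_data h A B \<pi>1 \<pi>2 \<theta>" and \<sigma>: "bij \<sigma>"
  shows "fs_data (inv \<sigma> \<circ> h \<circ> \<sigma>) A B (\<pi>1 \<circ> \<sigma>) (\<pi>2 \<circ> \<sigma>) \<theta>"
proof -
  have inv: "\<sigma> (inv \<sigma> x) = x" for x
    using \<sigma> by (simp add: bij_is_surj surj_f_inv_f)
  have image: "\<sigma> ` range (inv \<sigma> \<circ> h \<circ> \<sigma>) = range h"
  proof -
    have "\<sigma> \<circ> (inv \<sigma> \<circ> h \<circ> \<sigma>) = h \<circ> \<sigma>"
      by (simp add: fun_eq_iff inv)
    then show ?thesis
      using bij_is_surj[OF \<sigma>] by (metis image_comp)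
  qed
  have "bij_betw \<sigma> (range (inv \<sigma> \<circ> h \<circ> \<sigma>)) (range h)"
    unfolding bij_betw_def using image inj_on_subset[OF bij_is_inj[OF \<sigma>]] by blast
  then have "bij_betw ((\<lambda>p. (\<pi>1 p, \<pi>2 p)) \<circ> \<sigma>) (range (inv \<sigma> \<circ> h \<circ> \<sigma>)) (A \<times> B)"
    by (rule bij_betw_trans) (use data in \<open>simp add: fs_data_def\<close>)
  with data show ?thesis
    unfolding fs_data_def by (auto simp: fun_eq_iff inv comp_def)
qed

lemma fs_map_pullback:
  assumes data: "fs_data h A B \<pi>1 \<pi>2 \<theta>" and \<sigma>: "bij \<sigma>"
  shows "map_prod \<sigma> \<sigma> \<circ> fs_map (inv \<sigma> \<circ> h \<circ> \<sigma>) (\<pi>1 \<circ> \<sigma>) (\<pi>2 \<circ> \<sigma>) \<theta> =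
    fs_map h \<pi>1 \<pi>2 \<theta> \<circ> map_prod \<sigma> \<sigma>"
proof -
  have inv: "\<sigma> (inv \<sigma> x) = x" for x
    using \<sigma> by (simp add: bij_is_surj surj_f_inv_f)
  let ?R' = "fs_map (inv \<sigma> \<circ> h \<circ> \<sigma>) (\<pi>1 \<circ> \<sigma>) (\<pi>2 \<circ> \<sigma>) \<theta>"
  have range: "\<sigma> p \<in> range h" if "p \<in> range (inv \<sigma> \<circ> h \<circ> \<sigma>)" for p
    using that by (auto simp: inv)
  have "fs_map h \<pi>1 \<pi>2 \<theta> (\<sigma> x, \<sigma> y) = (\<sigma> (fst (?R' (x, y))), \<sigma> (snd (?R' (x, y))))" for x y
    unfolding fs_map_eq_iff_coords[OF data]
    using fs_map_value_coords[OF fs_data_pullback[OF data \<sigma>], of x y] range by (simp add: inv)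
  then show ?thesis by (auto simp: fun_eq_iff prod_eq_iff)
qed

lemma fs_automorphism_iff:
  assumes data: "fs_data h A B \<pi>1 \<pi>2 \<theta>"
  shows "fs_automorphism (fs_map h \<pi>1 \<pi>2 \<theta>) \<sigma> \<longleftrightarrow>
    bij \<sigma> \<and> \<sigma> \<circ> h = h \<circ> \<sigma> \<and>
    (\<exists>\<sigma>A \<sigma>B. bij_betw \<sigma>A A A \<and> bij_betw \<sigma>B B B \<and>
       (\<forall>p \<in> range h. \<pi>1 (\<sigma> p) = \<sigma>A (\<pi>1 p)) \<and>
       (\<forall>p \<in> range h. \<pi>2 (\<sigma> p) = \<sigma>B (\<pi>2 p)) \<and>
       (\<forall>b \<in> B. \<sigma>B (\<theta> b) = \<theta> (\<sigma>B b)))"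
proof (cases "bij \<sigma>")
  case True
  let ?R = "fs_map h \<pi>1 \<pi>2 \<theta>"
  let ?R' = "fs_map (inv \<sigma> \<circ> h \<circ> \<sigma>) (\<pi>1 \<circ> \<sigma>) (\<pi>2 \<circ> \<sigma>) \<theta>"
  have inv: "\<sigma> (inv \<sigma> x) = x" "inv \<sigma> (\<sigma> x) = x" for x
    using True by (simp_all add: bij_is_surj surj_f_inv_f bij_is_inj)
  have "inj (map_prod \<sigma> \<sigma>)"
    using True by (simp add: bij_is_inj prod.inj_map)
  then have "fs_automorphism ?R \<sigma> \<longleftrightarrow> ?R = ?R'"
    using True unfolding fs_automorphism_def fs_map_pullback[OF data True, symmetric]
    by (simp add: fun_eq_iff inj_eq)
  moreover have "h = inv \<sigma> \<circ> h \<circ> \<sigma> \<longleftrightarrow> \<sigma> \<circ> h = h \<circ> \<sigma>"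
    unfolding fun_eq_iff comp_apply using inv by metis
  moreover have "(\<forall>b \<in> B. \<theta> (\<beta> b) = \<beta> (\<theta> b)) \<longleftrightarrow> (\<forall>b \<in> B. \<beta> (\<theta> b) = \<theta> (\<beta> b))" for \<beta>
    by metis
  ultimately show ?thesis
    using True fs_map_eq_iff_relabelling[OF data fs_data_pullback[OF data True]] by simp
qed (simp add: fs_automorphism_def)

section \<open>Classification of solutions and of their automorphisms\<close>

theorem theorem2p10:
  "(\<forall>(h :: 'x \<Rightarrow> 'x) (A :: 'a set) (B :: 'b set) \<pi>1 \<pi>2 \<theta>.
      fs_data h A B \<pi>1 \<pi>2 \<theta> \<longrightarrow> fs_solution (fs_map h \<pi>1 \<pi>2 \<theta>)) \<and>
   (\<forall>R :: 'x \<times> 'x \<Rightarrow> 'x \<times> 'x. fs_solution R \<longrightarrow>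
      (\<exists>h (A :: 'x set) (B :: 'x set) \<pi>1 \<pi>2 \<theta>.
         fs_data h A B \<pi>1 \<pi>2 \<theta> \<and> R = fs_map h \<pi>1 \<pi>2 \<theta>)) \<and>
   (\<forall>(h :: 'x \<Rightarrow> 'x) (A :: 'a set) (B :: 'b set) \<pi>1 \<pi>2 \<theta>
      (h' :: 'x \<Rightarrow> 'x) (A' :: 'c set) (B' :: 'd set) \<pi>1' \<pi>2' \<theta>'.
      fs_data h A B \<pi>1 \<pi>2 \<theta> \<longrightarrow> fs_data h' A' B' \<pi>1' \<pi>2' \<theta>' \<longrightarrow>
      (fs_map h \<pi>1 \<pi>2 \<theta> = fs_map h' \<pi>1' \<pi>2' \<theta>' \<longleftrightarrow>
        h = h' \<and>
        (\<exists>\<alpha> \<beta>. bij_betw \<alpha> A A' \<and> bij_betw \<beta> B B' \<and>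
           (\<forall>p \<in> range h. \<pi>1' p = \<alpha> (\<pi>1 p)) \<and>
           (\<forall>p \<in> range h. \<pi>2' p = \<beta> (\<pi>2 p)) \<and>
           (\<forall>b \<in> B. \<theta>' (\<beta> b) = \<beta> (\<theta> b))))) \<and>
   (\<forall>R (h :: 'x \<Rightarrow> 'x) (A :: 'a set) (B :: 'b set) \<pi>1 \<pi>2 \<theta> \<sigma>.
      fs_data h A B \<pi>1 \<pi>2 \<theta> \<longrightarrow> R = fs_map h \<pi>1 \<pi>2 \<theta> \<longrightarrow>
      (fs_automorphism R \<sigma> \<longleftrightarrow>
        bij \<sigma> \<and> \<sigma> \<circ> h = h \<circ> \<sigma> \<and>
        (\<exists>\<sigma>A \<sigma>B. bij_betw \<sigma>A A A \<and> bij_betw \<sigma>B B B \<and>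
           (\<forall>p \<in> range h. \<pi>1 (\<sigma> p) = \<sigma>A (\<pi>1 p)) \<and>
           (\<forall>p \<in> range h. \<pi>2 (\<sigma> p) = \<sigma>B (\<pi>2 p)) \<and>
           (\<forall>b \<in> B. \<sigma>B (\<theta> b) = \<theta> (\<sigma>B b)))))"
  by (intro conjI allI impI)
    (blast intro: fs_map_solution, blast intro: fs_solution_has_data,
      erule (1) fs_map_eq_iff_relabelling, simp only: fs_automorphism_iff)

end
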